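(* Let $\Sigma$ be a connected orientable surface of finite type with negative Euler characteristic, let $P$ and $T$ be pants decompositions of $\Sigma$, and let $N$ be the number of curves in a pants decomposition of $\Sigma$. For every integer $k\ge 1$, if each curve of $P$ has curve complex distance at least $k$ from every curve of $T$, then \[ d_{\mathcal{C}^*}(P,T)\ \ge\ k(N-1)+1, \] where $d_{\mathcal{C}^*}$ is the distance in the dual curve complex of $\Sigma$.
   Context: Curve complex: the graph whose vertices are isotopy classes of essential simple closed curves in $\Sigma$, two vertices being joined by an edge iff they have disjoint representatives; the curve complex distance is the path metric with edges of length one. A pants decomposition of $\Sigma$ is a maximal collection of pairwise disjoint, pairwise non-isotopic essential simple closed curves (up to isotopy). Dual curve complex $C^*(\Sigma)$: the graph whose vertices are the pants decompositions of $\Sigma$, two being joined by an edge if they differ by replacing a single curve with another curve that is disjoint from the remaining curves, resulting in a new pants decomposition. $d_{\mathcal{C}^*}$ is the path metric on this graph with edges of length one. *)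

theory Defs
  imports "HOL-Analysis.Analysis" "HOL-Homology.Homology"
begin

section \<open>Surfaces of finite type\<close>

text \<open>
  Surfaces are topological 2-manifolds, possibly with boundary. Interior points are those with a
  planar neighbourhood; by invariance of domain all other points are boundary points.
\<close>

definition surface :: "'a topology \<Rightarrow> bool" where
  "surface X \<longleftrightarrow> Hausdorff_space X \<and> second_countable X \<and>
     (\<forall>x \<in> topspace X. \<exists>U V. openin X U \<and> x \<in> U \<and>
        openin (top_of_set {z::complex. 0 \<le> Im z}) V \<and>
        subtopology X U homeomorphic_space top_of_set V)"

definition surface_interior :: "'a topology \<Rightarrow> 'a set" where
  "surface_interior X = {x \<in> topspace X. \<exists>U (V::complex set). openin X U \<and> x \<in> U \<and> open V \<and>
     subtopology X U homeomorphic_space top_of_set V}"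

definition boundary_components :: "'a topology \<Rightarrow> 'a set set" where
  "boundary_components X =
     connected_components_of (subtopology X (topspace X - surface_interior X))"

text \<open>
  Finite type: a compact surface, possibly with boundary, with finitely many interior points
  removed. Taking the compact surface \<open>Y\<close> over the same type is no restriction: a nonempty surface
  is infinite, so adding finitely many points does not change its cardinality and \<open>Y\<close> can be
  transported to a topology on the set \<open>topspace X\<close>.
\<close>

definition finite_type_surface :: "'a topology \<Rightarrow> bool" where
  "finite_type_surface X \<longleftrightarrow> surface X \<and>
     (\<exists>(Y::'a topology) F. surface Y \<and> compact_space Y \<and> finite F \<and> F \<subseteq> surface_interior Y \<and>
        X homeomorphic_space subtopology Y (topspace Y - F))"

text \<open>
  An orientation is a locally consistent choice of generators of the local homology groups
  \<open>H\<^sub>2(M, M - {x})\<close> of the interior \<open>M\<close>.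
\<close>

definition orientable_surface :: "'a topology \<Rightarrow> bool" where
  "orientable_surface X \<longleftrightarrow>
     (let M = subtopology X (surface_interior X);
          H = (\<lambda>B. relative_homology_group 2 M (topspace M - B))
      in \<exists>\<mu>. (\<forall>x \<in> topspace M. \<mu> x \<in> carrier (H {x}) \<and> generate (H {x}) {\<mu> x} = carrier (H {x})) \<and>
             (\<forall>x \<in> topspace M. \<exists>B. openin M B \<and> x \<in> B \<and>
                (\<exists>\<beta> \<in> carrier (H B). \<forall>y \<in> B.
                   hom_induced 2 M (topspace M - B) M (topspace M - {y}) id \<beta> = \<mu> y)))"

text \<open>
  The rank of an abelian group (written multiplicatively) is the maximal number of
  \<open>\<int>\<close>-linearly independent elements. The supremum is a maximum for the finitely generated
  homology groups of a surface of finite type.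
\<close>

definition int_independent :: "('g, 'm) monoid_scheme \<Rightarrow> 'g set \<Rightarrow> bool" where
  "int_independent G A \<longleftrightarrow> finite A \<and> A \<subseteq> carrier G \<and>
     (\<forall>c :: 'g \<Rightarrow> int. finprod G (\<lambda>x. x [^]\<^bsub>G\<^esub> c x) A = \<one>\<^bsub>G\<^esub> \<longrightarrow> (\<forall>x \<in> A. c x = 0))"

definition group_rank :: "('g, 'm) monoid_scheme \<Rightarrow> nat" where
  "group_rank G = Sup {card A | A. int_independent G A}"

text \<open>Homology of a surface vanishes above degree 2, so the alternating sum stops there.\<close>

definition surface_euler_characteristic :: "'a topology \<Rightarrow> int" where
  "surface_euler_characteristic X =
     (\<Sum>i\<le>2. (- 1) ^ i * int (group_rank (homology_group (int i) X)))"

section \<open>Essential simple closed curves up to isotopy\<close>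

definition circle :: "complex topology" where
  "circle = top_of_set (sphere 0 1)"

text \<open>
  A closed curve is homotopic to a puncture if it can be pushed off every compact subset. On a
  surface of finite type every sufficiently small neighbourhood of infinity is a finite union of
  punctured discs; on a compact surface the condition never holds.
\<close>

definition homotopic_to_point :: "'a topology \<Rightarrow> (complex \<Rightarrow> 'a) \<Rightarrow> bool" where
  "homotopic_to_point X f \<longleftrightarrow> (\<exists>p. homotopic_with (\<lambda>_. True) circle X f (\<lambda>_. p))"

definition homotopic_to_puncture :: "'a topology \<Rightarrow> (complex \<Rightarrow> 'a) \<Rightarrow> bool" where
  "homotopic_to_puncture X f \<longleftrightarrow>
     (\<forall>K. compactin X K \<longrightarrow>
        (\<exists>g. homotopic_with (\<lambda>_. True) circle X f g \<and> g ` topspace circle \<inter> K = {}))"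

definition homotopic_to_boundary :: "'a topology \<Rightarrow> (complex \<Rightarrow> 'a) \<Rightarrow> bool" where
  "homotopic_to_boundary X f \<longleftrightarrow>
     (\<exists>g. homotopic_with (\<lambda>_. True) circle X f g \<and> embedding_map circle X g \<and>
          g ` topspace circle \<in> boundary_components X)"

text \<open>
  Curves are unparametrized, i.e. subsets of the surface; none of the notions below depends on
  the choice of parametrization.
\<close>

definition essential_scc :: "'a topology \<Rightarrow> 'a set \<Rightarrow> bool" where
  "essential_scc X C \<longleftrightarrow>
     (\<exists>f. embedding_map circle X f \<and> f ` topspace circle = C \<and>
          \<not> homotopic_to_point X f \<and> \<not> homotopic_to_puncture X f \<and> \<not> homotopic_to_boundary X f)"

text \<open>Isotopy is homotopy through embeddings.\<close>

definition isotopic_curves :: "'a topology \<Rightarrow> 'a set \<Rightarrow> 'a set \<Rightarrow> bool" where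
  "isotopic_curves X C D \<longleftrightarrow>
     (\<exists>f g. homotopic_with (embedding_map circle X) circle X f g \<and>
            f ` topspace circle = C \<and> g ` topspace circle = D)"

definition isotopy_class :: "'a topology \<Rightarrow> 'a set \<Rightarrow> 'a set set" where
  "isotopy_class X C = {D. isotopic_curves X C D}"

definition curve_classes :: "'a topology \<Rightarrow> 'a set set set" where
  "curve_classes X = isotopy_class X ` {C. essential_scc X C}"

section \<open>The curve complex and the dual curve complex\<close>

text \<open>
  Path metric of the graph with edge relation \<open>E\<close>: the least length of an edge path, and \<open>\<infinity>\<close> (the
  infimum of the empty set) if there is none.
\<close>

definition path_dist :: "('v \<times> 'v) set \<Rightarrow> 'v \<Rightarrow> 'v \<Rightarrow> enat" where
  "path_dist E x y = (INF n \<in> {n. (x, y) \<in> E ^^ n}. enat n)"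

definition curve_complex_edges :: "'a topology \<Rightarrow> ('a set set \<times> 'a set set) set" where
  "curve_complex_edges X =
     {(a, b). a \<in> curve_classes X \<and> b \<in> curve_classes X \<and> a \<noteq> b \<and>
              (\<exists>A \<in> a. \<exists>B \<in> b. disjnt A B)}"

definition curve_dist :: "'a topology \<Rightarrow> 'a set set \<Rightarrow> 'a set set \<Rightarrow> enat" where
  "curve_dist X = path_dist (curve_complex_edges X)"

text \<open>
  Collections of pairwise disjoint, pairwise non-isotopic curves up to isotopy: sets of distinct
  classes with simultaneously disjoint representatives.
\<close>

definition multicurve :: "'a topology \<Rightarrow> 'a set set set \<Rightarrow> bool" where
  "multicurve X P \<longleftrightarrow> P \<subseteq> curve_classes X \<and>
     (\<exists>r. (\<forall>c \<in> P. r c \<in> c) \<and> pairwise (\<lambda>c d. disjnt (r c) (r d)) P)"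

definition pants_decomposition :: "'a topology \<Rightarrow> 'a set set set \<Rightarrow> bool" where
  "pants_decomposition X P \<longleftrightarrow>
     multicurve X P \<and> (\<forall>Q. multicurve X Q \<and> P \<subseteq> Q \<longrightarrow> Q = P)"

text \<open>
  Disjointness of the new curve \<open>b\<close> from the remaining ones is part of the requirement that the
  result be a pants decomposition.
\<close>

definition dual_curve_complex_edges :: "'a topology \<Rightarrow> ('a set set set \<times> 'a set set set) set" where
  "dual_curve_complex_edges X =
     {(P, Q). pants_decomposition X P \<and> pants_decomposition X Q \<and>
              (\<exists>a \<in> P. \<exists>b. b \<notin> P \<and> Q = insert b (P - {a}))}"

definition dual_curve_dist :: "'a topology \<Rightarrow> 'a set set set \<Rightarrow> 'a set set set \<Rightarrow> enat" where
  "dual_curve_dist X = path_dist (dual_curve_complex_edges X)"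

end

theory Submission
  imports Defs
begin

text \<open>
  Give every curve class the level given by its distance from \<open>P\<close>. Classes in a common pants
  decomposition are adjacent in the curve complex, so their levels differ by at most one. Along an
  edge path from \<open>P\<close> to \<open>T\<close> and for \<open>0 < j < k\<close>, the first pants decomposition containing a class
  of level above \<open>j\<close> contains just one such class, and its other \<open>N - 1\<close> classes have level exactly
  \<open>j\<close>. With the \<open>N\<close> classes of \<open>P\<close> (level \<open>0\<close>) and the \<open>N\<close> classes of \<open>T\<close> (level at least \<open>k\<close>) this
  makes \<open>2 * N + (k - 1) * (N - 1)\<close> different classes on the path, while a path of length \<open>n\<close> meets
  at most \<open>N + n\<close>.
\<close>

lemma path_dist_self: "path_dist E x x = 0"
proof -
  have "path_dist E x x \<le> enat 0"
    unfolding path_dist_def by (rule INF_lower) simp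
  then show ?thesis by (simp flip: zero_enat_def)
qed

lemma path_dist_edge:
  assumes "(y, z) \<in> E"
  shows "path_dist E x z \<le> path_dist E x y + 1"
proof (cases "{n. (x, y) \<in> E ^^ n} = {}")
  case True
  then show ?thesis by (simp add: path_dist_def top_enat_def)
next
  case False
  then obtain m where "(x, y) \<in> E ^^ m" by blast
  \<comment> \<open>\<open>enat\<close> is well-ordered, so the infimum of a nonempty set of lengths
    is attained, here by a shortest path that the edge then extends.\<close>
  then have "path_dist E x y \<in> enat ` {n. (x, y) \<in> E ^^ n}"
    unfolding path_dist_def by (intro wellorder_InfI[of "enat m"]) simp
  then obtain n where n: "(x, y) \<in> E ^^ n" "path_dist E x y = enat n" by auto
  then have "(x, z) \<in> E ^^ Suc n" using assms by auto
  then have "path_dist E x z \<le> enat (Suc n)"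
    unfolding path_dist_def by (intro INF_lower) simp
  then show ?thesis using n(2) by (simp add: one_enat_def)
qed

lemma multicurve_edge:
  assumes "multicurve X P" "a \<in> P" "b \<in> P" "a \<noteq> b"
  shows "(a, b) \<in> curve_complex_edges X"
proof -
  obtain r where P: "P \<subseteq> curve_classes X" and r: "\<And>c. c \<in> P \<Longrightarrow> r c \<in> c"
    and disj: "pairwise (\<lambda>c d. disjnt (r c) (r d)) P"
    using assms(1) unfolding multicurve_def by blast
  have "disjnt (r a) (r b)" using pairwiseD[OF disj] assms(2-4) by simp
  moreover have "r a \<in> a" "r b \<in> b" using r assms(2,3) by simp_all
  moreover have "a \<in> curve_classes X" "b \<in> curve_classes X" using P assms(2,3) by auto
  ultimately show ?thesis
    using assms(4) unfolding curve_complex_edges_def by (intro CollectI case_prodI conjI bexI)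
qed

lemma exchange_card:
  assumes "finite A" "a \<in> A" "b \<notin> A"
  shows "card (insert b (A - {a})) = card A"
proof -
  have "card A > 0" using assms by (auto simp: card_gt_0_iff)
  then show ?thesis using assms by simp
qed

text \<open>The counting is purely combinatorial: topology enters only through the level function
  \<open>L\<close>, which varies by at most one within each \<open>f i\<close>.\<close>

lemma exchange_path_lower_bound:
  fixes f :: "nat \<Rightarrow> 'v set" and L :: "'v \<Rightarrow> enat"
  assumes fin: "finite (f 0)" and ne: "f 0 \<noteq> {}"
    and step: "\<And>i. i < n \<Longrightarrow> \<exists>a\<in>f i. \<exists>b. b \<notin> f i \<and> f (Suc i) = insert b (f i - {a})"
    and L_step: "\<And>i a b. i \<le> n \<Longrightarrow> a \<in> f i \<Longrightarrow> b \<in> f i \<Longrightarrow> L b \<le> L a + 1"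
    and L_start: "\<And>a. a \<in> f 0 \<Longrightarrow> L a = 0"
    and L_end: "\<And>b. b \<in> f n \<Longrightarrow> enat k \<le> L b"
    and k: "k \<ge> 1"
  shows "k * (card (f 0) - 1) + 1 \<le> n"
proof -
  define N where "N = card (f 0)"
  have N: "N \<ge> 1" using fin ne by (simp add: N_def Suc_le_eq card_gt_0_iff)
  have f: "finite (f i) \<and> card (f i) = N" if "i \<le> n" for i
    using that
  proof (induction i)
    case 0
    then show ?case using fin by (simp add: N_def)
  next
    case (Suc i)
    obtain a b where "a \<in> f i" "b \<notin> f i" "f (Suc i) = insert b (f i - {a})"
      using step[of i] Suc.prems by auto
    with Suc.IH Suc.prems exchange_card[of "f i" a b] show ?case by simp
  qed
  have union: "finite (\<Union>i\<le>m. f i) \<and> card (\<Union>i\<le>m. f i) \<le> N + m" if "m \<le> n" for m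
    using that
  proof (induction m)
    case 0
    then show ?case using fin by (simp add: N_def)
  next
    case (Suc m)
    obtain a b where b: "f (Suc m) = insert b (f m - {a})"
      using step[of m] Suc.prems by auto
    \<comment> \<open>The discarded \<open>a\<close> still belongs to \<open>f m\<close>, so the
      union gains nothing but \<open>b\<close>.\<close>
    have "(\<Union>i\<le>Suc m. f i) = insert b (\<Union>i\<le>m. f i)"
      using b by (auto simp: atMost_Suc)
    with Suc show ?case by (auto simp: card_insert_if)
  qed
  define U where "U = (\<Union>i\<le>n. f i)"
  have U: "finite U" "card U \<le> N + n" using union[of n] by (auto simp: U_def)
  have fU: "f i \<subseteq> U" if "i \<le> n" for i using that by (auto simp: U_def)
  \<comment> \<open>The restriction \<open>j < k\<close> keeps all of \<open>f n\<close> above level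
    \<open>j\<close>, so the path must cross that level.\<close>
  have levels: "N + j * (N - 1) \<le> card {c \<in> U. L c \<le> enat j}" if "j < k" for j
    using that
  proof (induction j)
    case 0
    have "f 0 \<subseteq> {c \<in> U. L c \<le> enat 0}" using fU[of 0] L_start by (auto simp: zero_enat_def)
    then show ?case using U by (simp add: N_def card_mono)
  next
    case (Suc j)
    define high where "high t \<longleftrightarrow> t \<le> n \<and> (\<exists>c\<in>f t. enat (Suc j) < L c)" for t
    obtain c where c: "c \<in> f n" using f[of n] N by fastforce
    have "enat (Suc j) < enat k" using Suc.prems by simp
    also have "enat k \<le> L c" using L_end c by simp
    finally have "high n" using c by (auto simp: high_def)
    moreover have "\<not> high 0" using L_start by (auto simp: high_def)
    \<comment> \<open>\<open>Suc t\<close> is the first time at which a level above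
      \<open>Suc j\<close> occurs.\<close>
    ultimately obtain t where t: "\<not> high t" "high (Suc t)"
      using ex_least_nat_less[of high n] by auto
    then have tn: "Suc t \<le> n" by (simp add: high_def)
    then have low: "L c \<le> enat (Suc j)" if "c \<in> f t" for c
      using t(1) that by (auto simp: high_def not_less)
    obtain a b where ab: "f (Suc t) = insert b (f t - {a})"
      using step[of t] tn by auto
    \<comment> \<open>Whatever survives from \<open>f t\<close> is low, so only the newcomer
      \<open>b\<close> can be high.\<close>
    have Lb: "enat (Suc j) < L b" using t(2) low ab by (auto simp: high_def not_less[symmetric])
    \<comment> \<open>Survivors are squeezed: they were low in \<open>f t\<close>, yet they share
      \<open>f (Suc t)\<close> with the high \<open>b\<close>.\<close>
    have eq: "L c = enat (Suc j)" if "c \<in> f (Suc t) - {b}" for c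
    proof (rule antisym)
      show "L c \<le> enat (Suc j)" using that low ab by auto
      have "L b \<le> L c + 1" using L_step[OF tn] that ab by auto
      with Lb show "enat (Suc j) \<le> L c"
        by (cases "L c"; cases "L b") (auto simp: one_enat_def)
    qed
    have le: "L c \<le> enat (Suc j)" if "L c \<le> enat j" for c
      using that by (cases "L c") auto
    have sub: "{c \<in> U. L c \<le> enat j} \<union> (f (Suc t) - {b}) \<subseteq> {c \<in> U. L c \<le> enat (Suc j)}"
      using fU[OF tn] eq le by auto
    have disj: "{c \<in> U. L c \<le> enat j} \<inter> (f (Suc t) - {b}) = {}"
    proof -
      have "\<not> L c \<le> enat j" if "c \<in> f (Suc t) - {b}" for c
        unfolding eq[OF that] by simp
      then show ?thesis by blast
    qed
    have "b \<in> f (Suc t)" using ab by simp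
    then have "card (f (Suc t) - {b}) = N - 1" using f[OF tn] by simp
    then have "card {c \<in> U. L c \<le> enat j} + (N - 1)
        = card ({c \<in> U. L c \<le> enat j} \<union> (f (Suc t) - {b}))"
      using U f[OF tn] disj by (simp add: card_Un_disjoint)
    also have "\<dots> \<le> card {c \<in> U. L c \<le> enat (Suc j)}"
      using sub U by (intro card_mono) auto
    finally show ?case using Suc by simp
  qed
  \<comment> \<open>The last set starts at level \<open>k\<close>, so its \<open>N\<close> elements
    come on top of those counted up to level \<open>k - 1\<close>.\<close>
  have disj: "{c \<in> U. L c \<le> enat (k - 1)} \<inter> f n = {}"
  proof -
    have False if "c \<in> f n" "L c \<le> enat (k - 1)" for c
      using order_trans[OF L_end[OF that(1)] that(2)] k by simp
    then show ?thesis by blast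
  qed
  have "N + (k - 1) * (N - 1) + N \<le> card {c \<in> U. L c \<le> enat (k - 1)} + card (f n)"
    using levels[of "k - 1"] f[of n] k by simp
  also have "\<dots> = card ({c \<in> U. L c \<le> enat (k - 1)} \<union> f n)"
    using U f[of n] disj by (simp add: card_Un_disjoint)
  also have "\<dots> \<le> card U" using U fU[of n] by (intro card_mono) auto
  also have "\<dots> \<le> N + n" by (rule U)
  finally have "(k - 1) * (N - 1) + N \<le> n" by simp
  moreover have "(k - 1) * (N - 1) + N = k * (N - 1) + 1"
    using k N by (cases k) auto
  ultimately show ?thesis by (simp add: N_def)
qed

theorem theoremB:
  fixes S :: "'a topology" and P T :: "'a set set set" and N k :: nat
  assumes "finite_type_surface S"
    and "connected_space S"
    and "orientable_surface S"
    and "surface_euler_characteristic S < 0"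
    and "pants_decomposition S P"
    and "pants_decomposition S T"
    and "N = card P"
    and "k \<ge> 1"
    and "\<forall>a \<in> P. \<forall>b \<in> T. enat k \<le> curve_dist S a b"
  shows "ereal_of_enat (dual_curve_dist S P T) \<ge> ereal (real k * (real N - 1) + 1)"
\<comment> \<open>\<open>card\<close> is \<open>0\<close> for infinite sets too, so this case covers
  an empty or infinite \<open>P\<close>; the real bound is then \<open>1 - k\<close>, at most
  \<open>0\<close>. Otherwise \<open>P\<close> is finite and nonempty.\<close>
proof (cases "N = 0")
  case True
  then have "ereal (real k * (real N - 1) + 1) \<le> 0" using assms(8) by simp
  also have "0 \<le> ereal_of_enat (dual_curve_dist S P T)" by simp
  finally show ?thesis .
next
  case False
  then have P: "finite P" "P \<noteq> {}" using assms(7) by (simp_all add: card_eq_0_iff)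
  define L where "L c = (INF a\<in>P. curve_dist S a c)" for c
  have L_edge: "L c \<le> L b + 1" if "(b, c) \<in> curve_complex_edges S" for b c
  proof -
    obtain p where "p \<in> P" using P by blast
    \<comment> \<open>Some curve of \<open>P\<close> realizes the level of \<open>b\<close>, and a
      path from that curve extends along the edge.\<close>
    then have "L b \<in> (\<lambda>a. curve_dist S a b) ` P"
      unfolding L_def by (intro wellorder_InfI[of "curve_dist S p b"]) simp
    then obtain a where a: "a \<in> P" "L b = curve_dist S a b" by auto
    have "L c \<le> curve_dist S a c" unfolding L_def using a by (intro INF_lower)
    also have "\<dots> \<le> curve_dist S a b + 1" unfolding curve_dist_def by (rule path_dist_edge[OF that])
    finally show ?thesis using a by simp
  qed
  have "enat (k * (N - 1) + 1) \<le> dual_curve_dist S P T"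
    unfolding dual_curve_dist_def path_dist_def
  proof (rule INF_greatest)
    fix n assume "n \<in> {n. (P, T) \<in> dual_curve_complex_edges S ^^ n}"
    then obtain f where f0: "f 0 = P" and fn: "f n = T"
      and edge: "\<And>i. i < n \<Longrightarrow> (f i, f (Suc i)) \<in> dual_curve_complex_edges S"
      by (auto simp: relpow_fun_conv)
    \<comment> \<open>Each edge vouches for its source; the endpoint \<open>T\<close> is covered by
      hypothesis, also when \<open>n = 0\<close>.\<close>
    have multi: "multicurve S (f i)" if "i \<le> n" for i
      using that edge[of i] assms(6) fn
      by (cases "i = n") (auto simp: dual_curve_complex_edges_def pants_decomposition_def)
    have "k * (card (f 0) - 1) + 1 \<le> n"
    proof (rule exchange_path_lower_bound[where L = L])
      show "finite (f 0)" "f 0 \<noteq> {}" using P f0 by auto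
      show "\<exists>a\<in>f i. \<exists>b. b \<notin> f i \<and> f (Suc i) = insert b (f i - {a})" if "i < n" for i
        using edge[OF that] by (auto simp: dual_curve_complex_edges_def)
      show "L b \<le> L a + 1" if "i \<le> n" "a \<in> f i" "b \<in> f i" for i a b
      proof (cases "a = b")
        case True
        then show ?thesis by simp
      next
        case False
        then show ?thesis by (intro L_edge multicurve_edge[OF multi[OF that(1)] that(2,3)])
      qed
      show "L a = 0" if "a \<in> f 0" for a
      proof -
        have "L a \<le> curve_dist S a a" unfolding L_def using that f0 by (intro INF_lower) simp
        then show ?thesis by (simp add: curve_dist_def path_dist_self)
      qed
      show "enat k \<le> L b" if "b \<in> f n" for b
        unfolding L_def using that fn assms(9) by (intro INF_greatest) blast
      show "k \<ge> 1" by (rule assms(8))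
    qed
    then show "enat (k * (N - 1) + 1) \<le> enat n" using f0 assms(7) by simp
  qed
  then have "ereal_of_enat (enat (k * (N - 1) + 1)) \<le> ereal_of_enat (dual_curve_dist S P T)"
    by (simp only: ereal_of_enat_le_iff)
  \<comment> \<open>Truncated subtraction agrees with the real one because \<open>N\<close> is
    positive.\<close>
  moreover have "real (k * (N - 1) + 1) = real k * (real N - 1) + 1"
    using False by (simp add: Suc_le_eq of_nat_diff)
  ultimately show ?thesis by (simp only: ereal_of_enat_simps)
qed

end
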